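(* Let $z,\lambda_i,x_i^-,x_i^+,g_i^-\in\mathbb R^n$ and symmetric positive definite $B_i\in\mathbb R^{n\times n}$, $i=1,\dots,N$, be the current data of Consensus BFGS ALADIN with penalty parameter $\rho>0$. Let the gradients $g_i\in\mathbb R^n$ and the symmetric positive definite Hessian approximations $B_i^+\in\mathbb R^{n\times n}$ be obtained from them by the decoding formulas (gradient decoding and damped BFGS update) given in the context. Then the $z$-component $z^+_{\mathrm{BFGS}}$ of the solution of the consensus quadratic program $$\min_{\Delta x_1,\dots,\Delta x_N,\,z\in\mathbb R^n}\ \sum_{i=1}^N\Big(\tfrac12\Delta x_i^\top B_i^+\Delta x_i+g_i^\top\Delta x_i\Big)\quad\text{s.t.}\quad \Delta x_i+x_i^+=z,\quad i=1,\dots,N,$$ is given by $$z^+_{\mathrm{BFGS}}=\Big(\sum_{i=1}^N B_i^+\Big)^{-1}\Big(\sum_{i=1}^N B_i^+x_i^+-\sum_{i=1}^N g_i\Big).$$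
   Context: Decoding formulas: for each $i$, set $g_i=\rho(z-x_i^+)-\lambda_i$, $s_i=x_i^+-x_i^-$ and $y_i=g_i-g_i^-$, where $g_i^-$ is the gradient from the previous iteration. If $y_i^\top s_i\le \tfrac15 s_i^\top B_is_i$, replace $y_i$ by $y_i+\theta(B_is_i-y_i)$ with $\theta=\dfrac{0.2\,s_i^\top B_is_i-s_i^\top y_i}{s_i^\top B_is_i-s_i^\top y_i}$; otherwise leave $y_i$ unchanged. Then $$B_i^+=B_i-\frac{B_is_is_i^\top B_i}{s_i^\top B_is_i}+\frac{y_iy_i^\top}{s_i^\top y_i}$$ (with $s_i\neq 0$, so that the expressions make sense). The damping of $y_i$ is used to ensure that $B_i^+$ is positive definite. In the algorithm, $x_i^+$ is the minimizer of $x\mapsto f_i(x)+\lambda_i^\top x+\frac{\rho}{2}\|x-z\|^2$, where $f_i$ is the local objective, and $g_i$ is the corresponding (sub)gradient of $f_i$ at $x_i^+$. *)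

theory Defs
  imports "HOL-Analysis.Analysis"
begin

definition sym_pos_def :: "real^'n^'n \<Rightarrow> bool" where
  "sym_pos_def A \<longleftrightarrow> transpose A = A \<and> (\<forall>v. v \<noteq> 0 \<longrightarrow> 0 < v \<bullet> (A *v v))"

definition decode_gradient :: "real \<Rightarrow> real^'n \<Rightarrow> real^'n \<Rightarrow> real^'n \<Rightarrow> real^'n" where
  "decode_gradient \<rho> z lam xp = \<rho> *\<^sub>R (z - xp) - lam"

text \<open>Powell's damping of the gradient difference \<open>y\<close>.\<close>

definition damp :: "real^'n^'n \<Rightarrow> real^'n \<Rightarrow> real^'n \<Rightarrow> real^'n" where
  "damp B s y =
     (if y \<bullet> s \<le> 1/5 * (s \<bullet> (B *v s))
      then let \<theta> = (0.2 * (s \<bullet> (B *v s)) - s \<bullet> y) / (s \<bullet> (B *v s) - s \<bullet> y)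
           in y + \<theta> *\<^sub>R (B *v s - y)
      else y)"

definition outer :: "real^'n \<Rightarrow> real^'n \<Rightarrow> real^'n^'n" where
  "outer u v = (\<chi> i j. u $ i * v $ j)"

definition bfgs_update :: "real^'n^'n \<Rightarrow> real^'n \<Rightarrow> real^'n \<Rightarrow> real^'n^'n" where
  "bfgs_update B s y =
     B - (B ** outer s s ** B) /\<^sub>R (s \<bullet> (B *v s)) + outer y y /\<^sub>R (s \<bullet> y)"

definition decode_hessian ::
  "real^'n^'n \<Rightarrow> real^'n \<Rightarrow> real^'n \<Rightarrow> real^'n \<Rightarrow> real^'n \<Rightarrow> real^'n^'n" where
  "decode_hessian B xm xp gm g =
     (let s = xp - xm; y = g - gm in bfgs_update B s (damp B s y))"

text \<open>The consensus quadratic program. The agents \<open>1, \<dots>, N\<close> are the elements of the finite index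
  type \<open>'m\<close>; a candidate is a pair of the increments \<open>dx\<close> and the consensus variable \<open>w\<close>.\<close>

definition qp_objective ::
  "('m::finite \<Rightarrow> real^'n^'n) \<Rightarrow> ('m \<Rightarrow> real^'n) \<Rightarrow> ('m \<Rightarrow> real^'n) \<times> (real^'n) \<Rightarrow> real" where
  "qp_objective H g = (\<lambda>(dx, w). \<Sum>i\<in>UNIV. (1/2 * (dx i \<bullet> (H i *v dx i)) + g i \<bullet> dx i))"

definition qp_feasible ::
  "('m::finite \<Rightarrow> real^'n) \<Rightarrow> ('m \<Rightarrow> real^'n) \<times> (real^'n) \<Rightarrow> bool" where
  "qp_feasible xp = (\<lambda>(dx, w). \<forall>i. dx i + xp i = w)"

definition qp_solution ::
  "('m::finite \<Rightarrow> real^'n^'n) \<Rightarrow> ('m \<Rightarrow> real^'n) \<Rightarrow> ('m \<Rightarrow> real^'n) \<Rightarrow>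
     ('m \<Rightarrow> real^'n) \<times> (real^'n) \<Rightarrow> bool" where
  "qp_solution H g xp = is_arg_min (qp_objective H g) (qp_feasible xp)"

end

theory Submission
  imports Defs
begin

text \<open>Damping forces \<open>s \<bullet> y > 0\<close>: after it, the curvature \<open>s \<bullet> y\<close> is at least a fifth of
  \<open>s \<bullet> B s\<close>. Under this condition the rank-two update stays positive definite, because
  subtracting \<open>B s s\<^sup>T B / (s\<^sup>T B s)\<close> leaves the \<open>B\<close>-energy of the component of a vector that is
  \<open>B\<close>-orthogonal to \<open>s\<close>, hence vanishes only on the line of \<open>s\<close>, and there \<open>y y\<^sup>T / (s\<^sup>T y)\<close> is
  positive. So the sum \<open>S\<close> of the updated Hessians is positive definite as well, thus invertible.

  The constraints determine the increments from the consensus variable, \<open>\<Delta>x\<^sub>i = w - x\<^sub>i\<close>, so the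
  program is the unconstrained minimization over \<open>w\<close> of a quadratic function with Hessian \<open>S\<close>
  (lemma \<open>reduced_objective_expansion\<close>). Its stationarity equation
  \<open>S w = (\<Sum>i. B\<^sub>i x\<^sub>i) - (\<Sum>i. g\<^sub>i)\<close> has the claimed point as its only solution, and at the
  displacement \<open>d\<close> from that point the objective has grown by \<open>d \<bullet> S d / 2\<close>, which gives existence and
  uniqueness at the same time.\<close>

lemma matrix_vector_mult_sum_rdistrib:
  fixes A :: "'i \<Rightarrow> real^'n^'k"
  shows "(\<Sum>i\<in>I. A i) *v v = (\<Sum>i\<in>I. A i *v v)"
  by (induction I rule: infinite_finite_induct) (simp_all add: matrix_vector_mult_add_rdistrib)

lemma outer_mult_vec: "outer u v *v w = (v \<bullet> w) *\<^sub>R u"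
  by (simp add: vec_eq_iff matrix_vector_mult_def outer_def inner_vec_def
      sum_distrib_left sum_distrib_right mult.assoc mult.commute mult.left_commute)

lemma transpose_outer: "transpose (outer u v) = outer v u"
  by (simp add: vec_eq_iff transpose_def outer_def)

lemma transpose_sum:
  fixes A :: "'i \<Rightarrow> real^'n^'k"
  shows "transpose (\<Sum>i\<in>I. A i) = (\<Sum>i\<in>I. transpose (A i))"
  by (simp add: vec_eq_iff transpose_def)

lemma sym_pos_def_inner_commute:
  assumes "sym_pos_def A"
  shows "u \<bullet> (A *v v) = v \<bullet> (A *v u)"
  using assms unfolding sym_pos_def_def
  by (metis dot_lmul_matrix inner_commute transpose_matrix_vector)

lemma sym_pos_def_inner_pos: "sym_pos_def A \<Longrightarrow> v \<noteq> 0 \<Longrightarrow> 0 < v \<bullet> (A *v v)"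
  by (simp add: sym_pos_def_def)

lemma sym_pos_def_imp_invertible:
  assumes "sym_pos_def A"
  shows "invertible A"
proof -
  have "v = 0" if "A *v v = 0" for v
    using sym_pos_def_inner_pos[OF assms, of v] that by fastforce
  then show ?thesis
    by (auto simp: invertible_left_inverse matrix_left_invertible_ker)
qed

lemma matrix_mul_matrix_inv: "invertible A \<Longrightarrow> A ** matrix_inv A = mat 1"
  unfolding invertible_def matrix_inv_def by (metis (mono_tags, lifting) someI_ex)

lemma sym_pos_def_sum:
  fixes A :: "'m::finite \<Rightarrow> real^'n^'n"
  assumes "\<And>i. sym_pos_def (A i)"
  shows "sym_pos_def (\<Sum>i\<in>UNIV. A i)"
  unfolding sym_pos_def_def
proof (intro conjI allI impI)
  show "transpose (\<Sum>i\<in>UNIV. A i) = (\<Sum>i\<in>UNIV. A i)"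
    using assms by (simp add: transpose_sum sym_pos_def_def)
next
  fix v :: "real^'n" assume "v \<noteq> 0"
  then have "0 < (\<Sum>i\<in>UNIV. v \<bullet> (A i *v v))"
    by (intro sum_pos) (auto simp: sym_pos_def_inner_pos[OF assms])
  then show "0 < v \<bullet> ((\<Sum>i\<in>UNIV. A i) *v v)"
    by (simp add: matrix_vector_mult_sum_rdistrib inner_sum_right)
qed

text \<open>The damping weight \<open>\<theta>\<close> is the one for which the damped vector has
  \<open>s \<bullet> y = 0.2 * (s \<bullet> B s)\<close>; without damping the curvature already exceeds this value.\<close>

lemma damp_curvature_pos:
  assumes "0 < s \<bullet> (B *v s)"
  shows "0 < s \<bullet> damp B s y"
proof (cases "y \<bullet> s \<le> 1/5 * (s \<bullet> (B *v s))")
  case True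
  let ?a = "s \<bullet> (B *v s)"
  have ne: "?a - s \<bullet> y \<noteq> 0"
    using True assms by (simp add: inner_commute)
  have "s \<bullet> damp B s y = s \<bullet> y + (0.2 * ?a - s \<bullet> y) / (?a - s \<bullet> y) * (?a - s \<bullet> y)"
    using True by (simp add: damp_def Let_def inner_add_right inner_diff_right)
  also have "\<dots> = 0.2 * ?a"
    using ne by simp
  finally show ?thesis
    using assms by simp
next
  case False
  then show ?thesis
    using assms by (simp add: damp_def inner_commute)
qed

lemma bfgs_update_quadratic_form:
  assumes "sym_pos_def B"
  shows "v \<bullet> (bfgs_update B s y *v v)
    = v \<bullet> (B *v v) - (v \<bullet> (B *v s))\<^sup>2 / (s \<bullet> (B *v s)) + (y \<bullet> v)\<^sup>2 / (s \<bullet> y)"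
proof -
  have "(B ** outer s s ** B) *v v = (v \<bullet> (B *v s)) *\<^sub>R (B *v s)"
    using sym_pos_def_inner_commute[OF assms, of s v]
    by (simp add: matrix_vector_mul_assoc[symmetric] outer_mult_vec matrix_vector_mult_scaleR)
  then show ?thesis
    by (simp add: bfgs_update_def matrix_vector_mult_add_rdistrib
        matrix_vector_mult_diff_rdistrib scaleR_matrix_vector_assoc[symmetric] outer_mult_vec
        inner_add_right inner_diff_right power2_eq_square divide_inverse inner_commute mult_ac)
qed

lemma transpose_bfgs_update:
  assumes "transpose B = B"
  shows "transpose (bfgs_update B s y) = bfgs_update B s y"
proof -
  have "transpose (B ** outer s s ** B) = B ** outer s s ** B"
    using assms by (simp add: matrix_transpose_mul transpose_outer matrix_mul_assoc)
  then show ?thesis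
    using assms transpose_outer[of y y] unfolding bfgs_update_def
    by (simp add: vec_eq_iff transpose_def)
qed

text \<open>Split \<open>v = w + t s\<close> with \<open>w\<close> orthogonal to \<open>s\<close> in the inner product of \<open>B\<close>. The first two
  terms of the quadratic form add up to \<open>w \<bullet> B w\<close>, so they can vanish only for \<open>v = t s\<close>; in
  that case the last term is \<open>t\<^sup>2 (s \<bullet> y)\<close>.\<close>

lemma sym_pos_def_bfgs_update:
  assumes B: "sym_pos_def B" and "s \<noteq> 0" and sy: "0 < s \<bullet> y"
  shows "sym_pos_def (bfgs_update B s y)"
  unfolding sym_pos_def_def
proof (intro conjI allI impI)
  show "transpose (bfgs_update B s y) = bfgs_update B s y"
    using B by (intro transpose_bfgs_update) (simp add: sym_pos_def_def)
next
  fix v :: "real^'a" assume "v \<noteq> 0"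
  define a where "a = s \<bullet> (B *v s)"
  define b where "b = v \<bullet> (B *v s)"
  define w where "w = v - (b / a) *\<^sub>R s"
  have a: "0 < a"
    using sym_pos_def_inner_pos[OF B \<open>s \<noteq> 0\<close>] by (simp add: a_def)
  have "w \<bullet> (B *v w) = v \<bullet> (B *v v) - b / a * b - b / a * (b - b / a * a)"
    using sym_pos_def_inner_commute[OF B, of s v]
    by (simp add: w_def matrix_vector_mult_diff_distrib matrix_vector_mult_scaleR
        inner_diff_left inner_diff_right a_def[symmetric] b_def[symmetric] algebra_simps)
  also have "\<dots> = v \<bullet> (B *v v) - b\<^sup>2 / a"
    using a by (simp add: power2_eq_square)
  finally have form: "v \<bullet> (bfgs_update B s y *v v) = w \<bullet> (B *v w) + (y \<bullet> v)\<^sup>2 / (s \<bullet> y)"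
    by (simp add: bfgs_update_quadratic_form[OF B] a_def b_def)
  show "0 < v \<bullet> (bfgs_update B s y *v v)"
  proof (cases "w = 0")
    case False
    then show ?thesis
      using sym_pos_def_inner_pos[OF B False] sy unfolding form
      by (intro add_pos_nonneg) auto
  next
    case True
    then have v: "v = (b / a) *\<^sub>R s"
      by (simp add: w_def)
    with \<open>v \<noteq> 0\<close> have "b / a \<noteq> 0"
      by auto
    moreover have "y \<bullet> v = b / a * (s \<bullet> y)"
      by (subst v) (simp add: inner_commute)
    ultimately have "y \<bullet> v \<noteq> 0"
      using sy by simp
    then show ?thesis
      using True sy by (simp add: form)
  qed
qed

lemma sym_pos_def_decode_hessian:
  assumes "sym_pos_def B" and "xp - xm \<noteq> 0"
  shows "sym_pos_def (decode_hessian B xm xp gm g)"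
  unfolding decode_hessian_def Let_def
  using assms by (intro sym_pos_def_bfgs_update damp_curvature_pos sym_pos_def_inner_pos)

text \<open>A quadratic function equals its second-order Taylor polynomial: the vector that \<open>d\<close>
  is multiplied with in the linear term is the gradient at \<open>w\<close> of the objective as a function of
  the consensus variable alone.\<close>

lemma reduced_objective_expansion:
  fixes H :: "'m::finite \<Rightarrow> real^'n^'n"
  assumes "\<And>i. sym_pos_def (H i)"
  shows "qp_objective H g (\<lambda>i. w + d - xp i, w + d) = qp_objective H g (\<lambda>i. w - xp i, w)
    + d \<bullet> ((\<Sum>i\<in>UNIV. H i) *v w - (\<Sum>i\<in>UNIV. H i *v xp i) + (\<Sum>i\<in>UNIV. g i))
    + 1/2 * (d \<bullet> ((\<Sum>i\<in>UNIV. H i) *v d))"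
proof -
  have step: "1/2 * ((w + d - xp i) \<bullet> (H i *v (w + d - xp i))) + g i \<bullet> (w + d - xp i)
      = (1/2 * ((w - xp i) \<bullet> (H i *v (w - xp i))) + g i \<bullet> (w - xp i))
        + d \<bullet> (H i *v w - H i *v xp i + g i) + 1/2 * (d \<bullet> (H i *v d))" for i
  proof -
    have "w + d - xp i = (w - xp i) + d" by simp
    moreover have "(w - xp i) \<bullet> (H i *v d) = d \<bullet> (H i *v (w - xp i))"
      by (rule sym_pos_def_inner_commute[OF assms])
    moreover have "g i \<bullet> d = d \<bullet> g i" by (rule inner_commute)
    moreover have "H i *v w - H i *v xp i = H i *v (w - xp i)"
      by (simp add: matrix_vector_mult_diff_distrib)
    ultimately show ?thesis
      by (simp only: matrix_vector_right_distrib inner_add_left inner_add_right)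
        (simp add: field_simps)
  qed
  show ?thesis
    unfolding qp_objective_def prod.case step
    by (simp add: matrix_vector_mult_sum_rdistrib inner_add_right inner_diff_right
        inner_sum_right sum.distrib sum_subtractf sum_distrib_left)
qed

lemma qp_feasible_iff: "qp_feasible xp p \<longleftrightarrow> p = (\<lambda>i. snd p - xp i, snd p)"
  by (cases p) (auto simp: qp_feasible_def fun_eq_iff eq_diff_eq)

text \<open>At a stationary point the linear term of the expansion disappears, so any other feasible
  point has a strictly larger objective.\<close>

lemma qp_solution_iff_stationary:
  fixes H :: "'m::finite \<Rightarrow> real^'n^'n"
  assumes H: "\<And>i. sym_pos_def (H i)"
    and stat: "(\<Sum>i\<in>UNIV. H i) *v w = (\<Sum>i\<in>UNIV. H i *v xp i) - (\<Sum>i\<in>UNIV. g i)"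
  shows "qp_solution H g xp p \<longleftrightarrow> p = (\<lambda>i. w - xp i, w)"
proof -
  let ?q = "\<lambda>u. (\<lambda>i. u - xp i, u)"
  have less: "qp_objective H g (?q w) < qp_objective H g (?q u)" if "u \<noteq> w" for u
    using reduced_objective_expansion[where H = H and g = g and xp = xp and w = w and d = "u - w"] H stat
      sym_pos_def_inner_pos[OF sym_pos_def_sum[of H], OF H, of "u - w"] that
    by simp
  have feas: "qp_feasible xp (?q u)" for u
    by (simp add: qp_feasible_def)
  show ?thesis
  proof
    assume sol: "qp_solution H g xp p"
    then have p: "p = ?q (snd p)"
      by (simp add: qp_solution_def is_arg_min_def qp_feasible_iff[symmetric])
    have "\<not> qp_objective H g (?q w) < qp_objective H g p"
      using sol feas by (simp add: qp_solution_def is_arg_min_def)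
    then have "snd p = w"
      using less[of "snd p"] p by metis
    then show "p = ?q w"
      using p by simp
  next
    assume p: "p = ?q w"
    have "\<not> qp_objective H g q < qp_objective H g (?q w)" if "qp_feasible xp q" for q
    proof -
      have "q = ?q (snd q)"
        using that by (simp add: qp_feasible_iff[symmetric])
      then show ?thesis
        using less[of "snd q"] by (metis order_less_asym order_less_irrefl)
    qed
    then show "qp_solution H g xp p"
      using p feas by (simp add: qp_solution_def is_arg_min_def)
  qed
qed

theorem theorem1:
  fixes \<rho> :: real and z :: "real^'n"
    and lam xm xp gm g :: "'m::finite \<Rightarrow> real^'n"
    and B Bp :: "'m \<Rightarrow> real^'n^'n"
  assumes "\<rho> > 0"
    and "\<forall>i. sym_pos_def (B i)"
    and "\<forall>i. xp i - xm i \<noteq> 0"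
    and "\<forall>i. g i = decode_gradient \<rho> z (lam i) (xp i)"
    and "\<forall>i. Bp i = decode_hessian (B i) (xm i) (xp i) (gm i) (g i)"
  shows "(\<forall>i. sym_pos_def (Bp i)) \<and>
    invertible (\<Sum>i\<in>UNIV. Bp i) \<and>
    (\<exists>!p. qp_solution Bp g xp p) \<and>
    (\<forall>dx zp. qp_solution Bp g xp (dx, zp) \<longrightarrow>
      zp = matrix_inv (\<Sum>i\<in>UNIV. Bp i) *v ((\<Sum>i\<in>UNIV. Bp i *v xp i) - (\<Sum>i\<in>UNIV. g i)))"
proof -
  let ?S = "\<Sum>i\<in>UNIV. Bp i"
  let ?r = "(\<Sum>i\<in>UNIV. Bp i *v xp i) - (\<Sum>i\<in>UNIV. g i)"
  let ?w = "matrix_inv ?S *v ?r"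
  have spd: "sym_pos_def (Bp i)" for i
    using assms(2,3,5) sym_pos_def_decode_hessian by metis
  have inv: "invertible ?S"
    by (intro sym_pos_def_imp_invertible sym_pos_def_sum spd)
  then have "?S *v ?w = ?r"
    by (simp add: matrix_vector_mul_assoc matrix_mul_matrix_inv)
  then have "qp_solution Bp g xp p \<longleftrightarrow> p = (\<lambda>i. ?w - xp i, ?w)" for p
    by (rule qp_solution_iff_stationary[of Bp, OF spd])
  then show ?thesis
    using spd inv by simp
qed

end
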